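(* A line graph is joined a-perfect if and only if it is h-perfect.
   Context: A line graph is a graph $L(H)$ whose nodes are the edges of a graph $H$ (parallel edges allowed), two adjacent iff they share an endnode. ${\rm STAB}(G)$ is the convex hull of incidence vectors of stable sets of $G$; $\alpha(G')$ is the maximum size of a stable set of $G'$; $x(S)=\sum_{i\in S}x_i$. The antiweb $A^k_n$ has nodes $0,\dots,n-1$ and edges $ij$ ($i\ne j$) iff $k\le|i-j|\le n-k$. The complete join of graphs is their disjoint union with all edges between different parts added. A joined antiweb constraint of $G$ is an inequality $\sum_{i\le t}\frac{1}{\alpha(A_i)}x(A_i)+x(Q)\le1$, where $A_1,\dots,A_t$ are antiwebs and $Q$ is a clique such that their complete join is an induced subgraph of $G$. ${\rm ASTAB}^*(G)$ is the set of nonnegative $x$ satisfying all joined antiweb constraints of $G$, and $G$ is joined a-perfect if ${\rm STAB}(G)={\rm ASTAB}^*(G)$. $G$ is h-perfect if ${\rm STAB}(G)$ equals the set of $x\ge0$ satisfying $x(Q)\le1$ for every clique $Q$ and $x(C)\le k$ for every odd hole (chordless cycle) $C$ of $G$ on $2k+1\ge5$ nodes. *)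

theory Defs
  imports "HOL-Analysis.Analysis"
begin

record 'a graph =
  nodes :: "'a set"
  adj :: "'a \<Rightarrow> 'a \<Rightarrow> bool"

definition simple_graph :: "'a graph \<Rightarrow> bool" where
  "simple_graph G \<longleftrightarrow> finite (nodes G) \<and>
     (\<forall>u v. adj G u v \<longrightarrow> u \<in> nodes G \<and> v \<in> nodes G \<and> u \<noteq> v \<and> adj G v u)"

definition induced_subgraph :: "'a graph \<Rightarrow> 'a set \<Rightarrow> 'a graph" where
  "induced_subgraph G W =
     \<lparr>nodes = nodes G \<inter> W, adj = (\<lambda>u v. u \<in> W \<and> v \<in> W \<and> adj G u v)\<rparr>"

definition graph_iso :: "'a graph \<Rightarrow> 'b graph \<Rightarrow> bool" where
  "graph_iso G H \<longleftrightarrow> (\<exists>f. bij_betw f (nodes G) (nodes H) \<and>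
     (\<forall>u\<in>nodes G. \<forall>v\<in>nodes G. adj G u v \<longleftrightarrow> adj H (f u) (f v)))"

definition stable_set :: "'a graph \<Rightarrow> 'a set \<Rightarrow> bool" where
  "stable_set G S \<longleftrightarrow> S \<subseteq> nodes G \<and> (\<forall>u\<in>S. \<forall>v\<in>S. \<not> adj G u v)"

definition clique :: "'a graph \<Rightarrow> 'a set \<Rightarrow> bool" where
  "clique G Q \<longleftrightarrow> Q \<subseteq> nodes G \<and> (\<forall>u\<in>Q. \<forall>v\<in>Q. u \<noteq> v \<longrightarrow> adj G u v)"

definition stability_number :: "'a graph \<Rightarrow> nat" where
  "stability_number G = Max (card ` {S. stable_set G S})"

text \<open>Multigraphs: parallel edges are distinct edges with the same pair of endnodes;
  there are no loops.\<close>

record ('v, 'e) multigraph =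
  vertices :: "'v set"
  edges :: "'e set"
  ends :: "'e \<Rightarrow> 'v set"

definition wf_multigraph :: "('v, 'e) multigraph \<Rightarrow> bool" where
  "wf_multigraph H \<longleftrightarrow> finite (vertices H) \<and> finite (edges H) \<and>
     (\<forall>e\<in>edges H. ends H e \<subseteq> vertices H \<and> card (ends H e) = 2)"

definition line_graph :: "('v, 'e) multigraph \<Rightarrow> 'e graph" where
  "line_graph H =
     \<lparr>nodes = edges H,
      adj = (\<lambda>e f. e \<in> edges H \<and> f \<in> edges H \<and> e \<noteq> f \<and> ends H e \<inter> ends H f \<noteq> {})\<rparr>"

lemma simple_graph_line_graph: "wf_multigraph H \<Longrightarrow> simple_graph (line_graph H)"
  by (auto simp: wf_multigraph_def simple_graph_def line_graph_def)

text \<open>The bounds are compared in \<^typ>\<open>int\<close> because \<open>n - k\<close> may be negative.\<close>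

definition antiweb :: "nat \<Rightarrow> nat \<Rightarrow> nat graph" where
  "antiweb k n =
     \<lparr>nodes = {..<n},
      adj = (\<lambda>i j. i < n \<and> j < n \<and> i \<noteq> j \<and>
              int k \<le> \<bar>int i - int j\<bar> \<and> \<bar>int i - int j\<bar> \<le> int n - int k)\<rparr>"

text \<open>Antiwebs have at least one node, so that their stability number is positive.\<close>

definition is_antiweb :: "'a graph \<Rightarrow> bool" where
  "is_antiweb G \<longleftrightarrow> (\<exists>k n. n \<ge> 1 \<and> graph_iso (antiweb k n) G)"

definition cycle_graph :: "nat \<Rightarrow> nat graph" where
  "cycle_graph n =
     \<lparr>nodes = {..<n},
      adj = (\<lambda>i j. i < n \<and> j < n \<and> (j = Suc i mod n \<or> i = Suc j mod n))\<rparr>"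

definition odd_hole :: "'a graph \<Rightarrow> nat \<Rightarrow> 'a set \<Rightarrow> bool" where
  "odd_hole G k C \<longleftrightarrow> 2 * k + 1 \<ge> 5 \<and> C \<subseteq> nodes G \<and>
     graph_iso (cycle_graph (2 * k + 1)) (induced_subgraph G C)"

text \<open>The graph \<open>G\<close> is the complete join of its induced subgraphs on the parts \<open>Ps\<close>.
  The parts are listed, not collected in a set, so that a repeated nonempty part is
  rejected by disjointness; empty parts are allowed.\<close>

definition is_complete_join :: "'a graph \<Rightarrow> 'a set list \<Rightarrow> bool" where
  "is_complete_join G Ps \<longleftrightarrow> nodes G = \<Union> (set Ps) \<and>
     (\<forall>i<length Ps. \<forall>j<length Ps. i \<noteq> j \<longrightarrow>
        Ps ! i \<inter> Ps ! j = {} \<and> (\<forall>u\<in>Ps ! i. \<forall>v\<in>Ps ! j. adj G u v))"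

text \<open>Either the list of antiwebs or the clique may be empty.\<close>

definition joined_antiweb :: "'a graph \<Rightarrow> 'a set list \<Rightarrow> 'a set \<Rightarrow> bool" where
  "joined_antiweb G As Q \<longleftrightarrow>
     (\<forall>A\<in>set As. A \<subseteq> nodes G \<and> is_antiweb (induced_subgraph G A)) \<and> clique G Q \<and>
     is_complete_join (induced_subgraph G (\<Union> (set As) \<union> Q)) (As @ [Q])"

text \<open>The node set may be a proper subset of the finite index type. The space
  of real vectors indexed by the nodes of \<open>G\<close> is the coordinate subspace of vectors
  vanishing outside \<open>nodes G\<close>.\<close>

definition vectors_on :: "'a::finite graph \<Rightarrow> (real ^ 'a) set" where
  "vectors_on G = {x. \<forall>i. i \<notin> nodes G \<longrightarrow> x $ i = 0}"

definition incidence_vector :: "'a::finite set \<Rightarrow> real ^ 'a" where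
  "incidence_vector S = (\<chi> i. if i \<in> S then 1 else 0)"

definition STAB :: "'a::finite graph \<Rightarrow> (real ^ 'a) set" where
  "STAB G = convex hull {incidence_vector S | S. stable_set G S}"

definition ASTAB_star :: "'a::finite graph \<Rightarrow> (real ^ 'a) set" where
  "ASTAB_star G = {x \<in> vectors_on G. (\<forall>i\<in>nodes G. 0 \<le> x $ i) \<and>
     (\<forall>As Q. joined_antiweb G As Q \<longrightarrow>
        (\<Sum>A\<leftarrow>As. 1 / real (stability_number (induced_subgraph G A)) * (\<Sum>i\<in>A. x $ i))
          + (\<Sum>i\<in>Q. x $ i) \<le> 1)}"

definition joined_a_perfect :: "'a::finite graph \<Rightarrow> bool" where
  "joined_a_perfect G \<longleftrightarrow> STAB G = ASTAB_star G"

definition h_perfect :: "'a::finite graph \<Rightarrow> bool" where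
  "h_perfect G \<longleftrightarrow> STAB G = {x \<in> vectors_on G. (\<forall>i\<in>nodes G. 0 \<le> x $ i) \<and>
     (\<forall>Q. clique G Q \<longrightarrow> (\<Sum>i\<in>Q. x $ i) \<le> 1) \<and>
     (\<forall>k C. odd_hole G k C \<longrightarrow> (\<Sum>i\<in>C. x $ i) \<le> real k)}"

end

theory Submission
  imports Defs
begin

text \<open>For a line graph, the joined antiweb constraints and the clique and odd hole constraints cut
  out the same polytope, so the convex hull of the stable sets plays no role. An odd hole on
  \<open>2 * k + 1\<close> nodes is an antiweb with stability number \<open>k\<close>. Conversely, if at least two parts
  of a join are nonempty, then every part lies in the neighbourhood of an edge and hence is the
  union of two cliques; the constraint is dominated by half the sum of two clique constraints. A
  single antiweb with parameters \<open>k\<close> and \<open>n\<close> is an odd hole, or is covered by at most as many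
  cliques as its stability number, or is not a line graph: for \<open>k \<ge> 3\<close> and \<open>n \<ge> 2 * k + 2\<close>
  it contains a claw, and for \<open>k = 2\<close> and odd \<open>n \<ge> 7\<close> it is an odd antihole, all of whose nodes
  would have to share an endnode.\<close>

section \<open>Graph isomorphisms and stability numbers\<close>

lemma nodes_induced_subgraph [simp]: "nodes (induced_subgraph G W) = nodes G \<inter> W"
  by (simp add: induced_subgraph_def)

lemma adj_induced_subgraph [simp]:
  "adj (induced_subgraph G W) u v \<longleftrightarrow> u \<in> W \<and> v \<in> W \<and> adj G u v"
  by (simp add: induced_subgraph_def)

lemma nodes_antiweb [simp]: "nodes (antiweb k n) = {..<n}"
  by (simp add: antiweb_def)

lemma nodes_cycle_graph [simp]: "nodes (cycle_graph n) = {..<n}"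
  by (simp add: cycle_graph_def)

lemma nodes_line_graph [simp]: "nodes (line_graph H) = edges H"
  by (simp add: line_graph_def)

lemma adj_line_graph:
  "adj (line_graph H) e f \<longleftrightarrow> e \<in> edges H \<and> f \<in> edges H \<and> e \<noteq> f \<and> ends H e \<inter> ends H f \<noteq> {}"
  by (simp add: line_graph_def)

lemma graph_iso_sym: "graph_iso G H \<Longrightarrow> graph_iso H G"
proof -
  assume "graph_iso G H"
  then obtain f where f: "bij_betw f (nodes G) (nodes H)"
    "\<And>u v. u \<in> nodes G \<Longrightarrow> v \<in> nodes G \<Longrightarrow> adj G u v \<longleftrightarrow> adj H (f u) (f v)"
    by (auto simp: graph_iso_def)
  let ?g = "inv_into (nodes G) f"
  have g: "bij_betw ?g (nodes H) (nodes G)"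
    by (rule bij_betw_inv_into[OF f(1)])
  moreover have "adj H u v \<longleftrightarrow> adj G (?g u) (?g v)" if "u \<in> nodes H" "v \<in> nodes H" for u v
    using f that g by (simp add: bij_betw_apply bij_betw_inv_into_right)
  ultimately show ?thesis by (auto simp: graph_iso_def)
qed

lemma graph_iso_trans: "graph_iso G H \<Longrightarrow> graph_iso H K \<Longrightarrow> graph_iso G K"
proof -
  assume "graph_iso G H" "graph_iso H K"
  then obtain f g where f: "bij_betw f (nodes G) (nodes H)"
    "\<forall>u\<in>nodes G. \<forall>v\<in>nodes G. adj G u v \<longleftrightarrow> adj H (f u) (f v)"
    and g: "bij_betw g (nodes H) (nodes K)"
    "\<forall>u\<in>nodes H. \<forall>v\<in>nodes H. adj H u v \<longleftrightarrow> adj K (g u) (g v)"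
    by (auto simp: graph_iso_def)
  show ?thesis unfolding graph_iso_def
  proof (intro exI[of _ "g \<circ> f"] conjI ballI)
    show "bij_betw (g \<circ> f) (nodes G) (nodes K)"
      using bij_betw_trans[OF f(1) g(1)] .
    show "adj G u v \<longleftrightarrow> adj K ((g \<circ> f) u) ((g \<circ> f) v)"
      if "u \<in> nodes G" "v \<in> nodes G" for u v
      using f g that by (simp add: bij_betw_apply)
  qed
qed

lemma card_le_stability_number:
  assumes "finite (nodes G)" "stable_set G S"
  shows "card S \<le> stability_number G"
proof -
  have "finite {S. stable_set G S}"
    by (rule finite_subset[of _ "Pow (nodes G)"]) (use assms(1) in \<open>auto simp: stable_set_def\<close>)
  then show ?thesis
    unfolding stability_number_def using assms(2) by (intro Max_ge) auto
qed

lemma stability_number_le: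
  assumes "finite (nodes G)" "\<And>S. stable_set G S \<Longrightarrow> card S \<le> m"
  shows "stability_number G \<le> m"
proof -
  have "finite {S. stable_set G S}"
    by (rule finite_subset[of _ "Pow (nodes G)"]) (use assms(1) in \<open>auto simp: stable_set_def\<close>)
  moreover have "stable_set G {}" by (simp add: stable_set_def)
  ultimately show ?thesis
    unfolding stability_number_def using assms(2) by (subst Max_le_iff) auto
qed

text \<open>The inverse isomorphism carries stable sets of \<open>H\<close> to stable sets of
  \<open>G\<close> of the same size.\<close>

lemma graph_iso_stability_number_le:
  assumes "graph_iso G H" "finite (nodes G)"
    and "\<And>S. stable_set G S \<Longrightarrow> card S \<le> m"
  shows "stability_number H \<le> m"
proof -
  obtain f where f: "bij_betw f (nodes H) (nodes G)"
    "\<forall>u\<in>nodes H. \<forall>v\<in>nodes H. adj H u v \<longleftrightarrow> adj G (f u) (f v)"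
    using graph_iso_sym[OF assms(1)] by (auto simp: graph_iso_def)
  show ?thesis
  proof (rule stability_number_le)
    show "finite (nodes H)" using f(1) assms(2) bij_betw_finite by auto
    fix S assume S: "stable_set H S"
    then have sub: "S \<subseteq> nodes H" by (simp add: stable_set_def)
    have "stable_set G (f ` S)"
      using S f sub unfolding stable_set_def bij_betw_def by blast
    moreover have "card (f ` S) = card S"
      using f(1) sub by (meson bij_betw_def card_image inj_on_subset)
    ultimately show "card S \<le> m" using assms(3) by metis
  qed
qed


section \<open>Odd holes as antiwebs\<close>

text \<open>For \<open>n = 2 * k + 1\<close> the only permitted differences are \<open>k\<close> and
  \<open>n - k = k + 1\<close>, and these are the two directions of a cyclic shift by
  \<open>k\<close>.\<close>

lemma adj_odd_antiweb_iff:
  "adj (antiweb k (2 * k + 1)) a b \<longleftrightarrow> a < 2 * k + 1 \<and> b < 2 * k + 1 \<and>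
     (b = (a + k) mod (2 * k + 1) \<or> a = (b + k) mod (2 * k + 1))" if "k \<ge> 1"
proof -
  \<comment> \<open>Since \<open>c + k\<close> is less than twice the modulus, at most one
    subtraction occurs.\<close>
  have *: "(c + k) mod (2 * k + 1) = (if c \<le> k then c + k else c - (k + 1))"
    if "c < 2 * k + 1" for c
    using that by (auto simp: mod_if[of "c + k"])
  show ?thesis
  proof (cases "a < 2 * k + 1 \<and> b < 2 * k + 1")
    case True
    then have "(a + k) mod (2 * k + 1) = (if a \<le> k then a + k else a - (k + 1))"
      "(b + k) mod (2 * k + 1) = (if b \<le> k then b + k else b - (k + 1))"
      using * by blast+
    then show ?thesis
      unfolding antiweb_def using True \<open>k \<ge> 1\<close>
      by (simp only: graph.simps) (auto split: if_splits)
  qed (auto simp: antiweb_def)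
qed

text \<open>Because \<open>k\<close> is coprime to \<open>2 * k + 1\<close>, multiplication by
  \<open>k\<close> permutes the residues; it turns steps of 1 into steps of
  \<open>k\<close>.\<close>

lemma cycle_graph_iso_antiweb:
  assumes "k \<ge> 1"
  shows "graph_iso (cycle_graph (2 * k + 1)) (antiweb k (2 * k + 1))"
proof -
  define n where "n = 2 * k + 1"
  define f where "f = (\<lambda>j. j * k mod n)"
  have n: "n > 0" by (simp add: n_def)
  \<comment> \<open>The factor \<open>k\<close> is cancelled over the integers, where
    \<open>i - j\<close> is not truncated.\<close>
  have cancel: "i = j" if "i * k mod n = j * k mod n" "i < n" "j < n" for i j :: nat
  proof -
    have "coprime (int n) (int k)" unfolding n_def coprime_int_iff
      by (rule coprimeI) (metis dvd_add_right_iff dvd_mult)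
    moreover have "int (i * k) mod int n = int (j * k) mod int n"
      using that(1) by (simp only: of_nat_mod[symmetric])
    then have "int n dvd (int i - int j) * int k"
      by (simp add: mod_eq_dvd_iff left_diff_distrib)
    ultimately have "int n dvd int i - int j"
      by (simp add: coprime_dvd_mult_left_iff)
    moreover have "\<bar>int i - int j\<bar> < int n" using that(2,3) by linarith
    ultimately show ?thesis
      using dvd_imp_le_int[of "int i - int j" "int n"] by force
  qed
  have inj: "inj_on f {..<n}"
    by (rule inj_onI, rule cancel) (simp_all add: f_def)
  have "f ` {..<n} \<subseteq> {..<n}" using n by (auto simp: f_def)
  then have bij: "bij_betw f {..<n} {..<n}"
    using inj by (simp add: bij_betw_def endo_inj_surj)
  have step: "f (Suc i mod n) = (f i + k) mod n" for i
    by (simp add: f_def mod_simps add.commute)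
  have "adj (cycle_graph n) i j \<longleftrightarrow> adj (antiweb k n) (f i) (f j)" if "i < n" "j < n" for i j
  proof -
    have lt: "f i < n" "f j < n" using n by (auto simp: f_def)
    have "adj (antiweb k n) (f i) (f j) \<longleftrightarrow> f j = f (Suc i mod n) \<or> f i = f (Suc j mod n)"
      unfolding step using adj_odd_antiweb_iff[OF assms, folded n_def] lt by blast
    also have "\<dots> \<longleftrightarrow> j = Suc i mod n \<or> i = Suc j mod n"
      using inj that n by (auto simp: inj_on_eq_iff)
    finally show ?thesis using that by (simp add: cycle_graph_def)
  qed
  then show ?thesis
    using bij unfolding graph_iso_def n_def[symmetric] by auto
qed

text \<open>The set of successors of a stable set has the same size and is disjoint from it.\<close>

lemma stable_set_cycle_graph_le:
  assumes "stable_set (cycle_graph n) S"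
  shows "2 * card S \<le> n"
proof (cases "n = 0")
  case True
  then show ?thesis using assms by (simp add: stable_set_def)
next
  case False
  let ?s = "\<lambda>i. Suc i mod n"
  have sub: "S \<subseteq> {..<n}" using assms by (simp add: stable_set_def)
  then have fin: "finite S" using finite_subset by blast
  have "inj_on ?s {..<n}" by (auto simp: inj_on_def mod_Suc split: if_splits)
  then have "card (?s ` S) = card S" using sub by (meson card_image inj_on_subset)
  moreover have "S \<inter> ?s ` S = {}"
    using assms False by (force simp: stable_set_def cycle_graph_def)
  then have "card (S \<union> ?s ` S) = card S + card (?s ` S)"
    using fin by (intro card_Un_disjoint) auto
  moreover have "card (S \<union> ?s ` S) \<le> card {..<n}"
    using sub False by (intro card_mono) auto
  ultimately show ?thesis by simp
qed

lemma odd_hole_is_antiweb: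
  "odd_hole G k C \<Longrightarrow> is_antiweb (induced_subgraph G C)"
  unfolding odd_hole_def is_antiweb_def
  using graph_iso_trans[OF graph_iso_sym[OF cycle_graph_iso_antiweb], of k]
  by (intro exI[of _ k] exI[of _ "2 * k + 1"]) auto

text \<open>With this bound, the antiweb constraint of \<open>C\<close> implies the odd hole
  constraint.\<close>

lemma odd_hole_stability_number:
  assumes "odd_hole G k C"
  shows "stability_number (induced_subgraph G C) \<le> k"
proof (rule graph_iso_stability_number_le)
  show "graph_iso (cycle_graph (2 * k + 1)) (induced_subgraph G C)"
    using assms by (simp add: odd_hole_def)
  show "card S \<le> k" if "stable_set (cycle_graph (2 * k + 1)) S" for S
    using stable_set_cycle_graph_le[OF that] by simp
qed simp


section \<open>Antiwebs in line graphs\<close>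

text \<open>The nodes adjacent to an edge \<open>c\<close> split according to the endnode of \<open>c\<close> they contain.\<close>

lemma line_graph_neighbourhood_cliques:
  assumes "wf_multigraph H" "\<And>e. e \<in> P \<Longrightarrow> adj (line_graph H) c e"
  obtains Q1 Q2 where "clique (line_graph H) Q1" "clique (line_graph H) Q2" "P = Q1 \<union> Q2"
proof (cases "P = {}")
  case True
  then show ?thesis using that[of "{}" "{}"] by (simp add: clique_def)
next
  case False
  then have "c \<in> edges H" using assms(2) by (auto simp: adj_line_graph)
  then obtain u v where uv: "ends H c = {u, v}"
    using assms(1) by (auto simp: wf_multigraph_def card_2_iff)
  show ?thesis
  proof (rule that)
    show "clique (line_graph H) {e \<in> P. u \<in> ends H e}"
      "clique (line_graph H) {e \<in> P. v \<in> ends H e}"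
      using assms(2) by (auto simp: clique_def adj_line_graph)
    show "P = {e \<in> P. u \<in> ends H e} \<union> {e \<in> P. v \<in> ends H e}"
      using assms(2) uv by (auto simp: adj_line_graph)
  qed
qed

text \<open>The neighbours of \<open>c\<close> are covered by two cliques, so two of any three lie
  in the same one.\<close>

lemma line_graph_claw_free:
  assumes "wf_multigraph H" "\<And>e. e \<in> {a, b, d} \<Longrightarrow> adj (line_graph H) c e"
    and "a \<noteq> b" "a \<noteq> d" "b \<noteq> d"
  shows "adj (line_graph H) a b \<or> adj (line_graph H) a d \<or> adj (line_graph H) b d"
proof -
  obtain Q1 Q2 where "clique (line_graph H) Q1" "clique (line_graph H) Q2" "{a, b, d} = Q1 \<union> Q2"
    using line_graph_neighbourhood_cliques[OF assms(1,2)] by blast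
  then have "a \<in> Q1 \<union> Q2" "b \<in> Q1 \<union> Q2" "d \<in> Q1 \<union> Q2" "clique (line_graph H) Q1" "clique (line_graph H) Q2"
    by auto
  then show ?thesis using assms(3-5) unfolding clique_def by blast
qed

text \<open>After wrapping around, the difference is \<open>n - d\<close>; the range from
  \<open>k\<close> to \<open>n - k\<close> is symmetric under this exchange.\<close>

lemma adj_antiweb_shift:
  assumes "r < n" "1 \<le> k" "k \<le> d" "d + k \<le> n"
  shows "adj (antiweb k n) r (if r + d < n then r + d else r + d - n)"
proof (cases "r + d < n")
  case True
  then show ?thesis using assms by (simp add: antiweb_def)
next
  case False
  then have "int (r + d - n) = int r + int d - int n" "r + d - n < r" using assms by linarith+
  then show ?thesis using False assms by (simp add: antiweb_def)
qed

text \<open>In an antihole, the edges \<open>i\<close>, \<open>i + 2\<close>, \<open>i + 4\<close> would have a common endnode, and it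
  would not depend on \<open>i\<close> because \<open>i\<close> and \<open>i + 2\<close> are not parallel. On an odd antihole,
  steps of length 2 reach every node.\<close>

lemma line_graph_no_odd_antihole:
  assumes wf: "wf_multigraph H" and n: "odd n" "n \<ge> 7"
    and f: "inj_on f {..<n}" "f ` {..<n} \<subseteq> edges H"
    and iso: "\<And>i j. i < n \<Longrightarrow> j < n \<Longrightarrow> adj (antiweb 2 n) i j \<longleftrightarrow> adj (line_graph H) (f i) (f j)"
  shows False
proof -
  \<comment> \<open>End sets indexed cyclically, so that shifts need no case distinction.\<close>
  define E where "E = (\<lambda>i. ends H (f (i mod n)))"
  have pos: "n > 0" using n by simp
  have mem: "f (i mod n) \<in> edges H" for i using f(2) pos by auto
  have E2: "card (E i) = 2" for i
    using wf mem by (simp add: E_def wf_multigraph_def)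
  have shift: "(i + d) mod n = (if i mod n + d < n then i mod n + d else i mod n + d - n)"
    if "d < n" for i d
  proof -
    have "(i + d) mod n = (i mod n + d) mod n" by (simp add: mod_simps)
    moreover have "i mod n < n" using pos by simp
    moreover from this have "i mod n + d - n < n" using that by linarith
    ultimately show ?thesis using that by (auto simp: mod_if[of "i mod n + d"])
  qed
  have meet: "E i \<inter> E (i + d) \<noteq> {}" if d: "2 \<le> d" "d + 2 \<le> n" for i d
  proof -
    have "i mod n < n" "d < n" using pos d by simp_all
    then have "adj (antiweb 2 n) (i mod n) ((i + d) mod n)"
      unfolding shift[OF \<open>d < n\<close>] using d by (intro adj_antiweb_shift) auto
    then show ?thesis using iso pos by (auto simp: E_def adj_line_graph)
  qed
  \<comment> \<open>Consecutive nodes are distinct and not adjacent in the antihole, so their edges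
    share no endnode.\<close>
  have disj: "E i \<inter> E (i + 1) = {}" for i
  proof -
    have lt: "i mod n < n" and one: "1 < n" using n by simp_all
    then have "\<not> adj (antiweb 2 n) (i mod n) ((i + 1) mod n)"
      unfolding shift[of 1 i, OF one] antiweb_def using n by (simp split: if_splits)
    moreover have "i mod n \<noteq> (i + 1) mod n"
      unfolding shift[of 1 i, OF one] using n lt by (auto split: if_splits)
    then have "f (i mod n) \<noteq> f ((i + 1) mod n)"
      using f(1) pos by (simp add: inj_on_eq_iff)
    ultimately show ?thesis using iso pos mem by (auto simp: E_def adj_line_graph)
  qed
  \<comment> \<open>\<open>E (i + 3)\<close> takes one endnode of \<open>E i\<close> and is disjoint
    from \<open>E (i + 2)\<close> and \<open>E (i + 4)\<close>. Both of these must therefore meet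
    \<open>E i\<close> in its other endnode. The distance 4 is admissible because
    \<open>n \<ge> 7\<close>.\<close>
  have triple: "\<exists>c. c \<in> E i \<and> c \<in> E (i + 2) \<and> c \<in> E (i + 4)" for i
  proof -
    obtain u v where "E i = {u, v}" using E2 by (meson card_2_iff)
    moreover have "E i \<inter> E (i + 2) \<noteq> {}" "E i \<inter> E (i + 3) \<noteq> {}" "E i \<inter> E (i + 4) \<noteq> {}"
      using n by (intro meet; simp)+
    moreover have "E (i + 2) \<inter> E (i + 3) = {}" "E (i + 3) \<inter> E (i + 4) = {}"
      using disj[of "i + 2"] disj[of "i + 3"] by (simp_all add: numeral_eq_Suc)
    ultimately show ?thesis by auto
  qed
  \<comment> \<open>Otherwise \<open>E i = E (i + 2)\<close>, but \<open>E (i + 3)\<close> meets the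
    former and misses the latter.\<close>
  have single: "c = d" if "c \<in> E i" "c \<in> E (i + 2)" "d \<in> E i" "d \<in> E (i + 2)" for c d i
  proof (rule ccontr)
    assume "c \<noteq> d"
    then have "E i = {c, d}" "E (i + 2) = {c, d}"
      using that E2[of i] E2[of "i + 2"] by (auto simp: card_2_iff)
    moreover have "E (i + 2) \<inter> E (i + 3) = {}"
      using disj[of "i + 2"] by (simp add: numeral_eq_Suc)
    moreover have "E i \<inter> E (i + 3) \<noteq> {}" using n by (intro meet; simp)
    ultimately show False by simp
  qed
  obtain u where u: "u \<in> E 0" "u \<in> E (0 + 2)" using triple[of 0] by blast
  have "u \<in> E (2 * m) \<and> u \<in> E (2 * m + 2)" for m
  proof (induction m)
    case 0
    then show ?case using u by (metis mult_0_right)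
  next
    case (Suc m)
    \<comment> \<open>The endnode \<open>c\<close> shared by three sets is also common to the first
      two, hence equal to \<open>u\<close>.\<close>
    obtain c where "c \<in> E (2 * m)" "c \<in> E (2 * m + 2)" "c \<in> E (2 * m + 4)"
      using triple by blast
    with Suc show ?case using single[of c "2 * m" u] by (auto simp: numeral_eq_Suc)
  qed
  \<comment> \<open>As \<open>n\<close> is odd, the even index \<open>n + 1\<close> wraps around to
    1, so \<open>u\<close> lies in the disjoint sets \<open>E 0\<close> and
    \<open>E 1\<close>.\<close>
  from this[of "(n + 1) div 2"] have "u \<in> E (n + 1)" using n(1) by simp
  also have "E (n + 1) = E 1" by (simp only: E_def mod_add_self1)
  finally show False using disj[of 0] u by auto
qed

section \<open>Clique covers and the constraint of a single antiweb\<close>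

lemma sum_UN_le:
  fixes x :: "'a \<Rightarrow> real"
  assumes "finite I" "\<And>r. r \<in> I \<Longrightarrow> finite (K r)" "\<And>i. 0 \<le> x i"
  shows "sum x (\<Union>r\<in>I. K r) \<le> (\<Sum>r\<in>I. sum x (K r))"
  using assms(1,2)
proof (induction I)
  case (insert r I)
  have "sum x (K r \<union> (\<Union>r\<in>I. K r)) \<le> sum x (K r) + sum x (\<Union>r\<in>I. K r)"
    using insert assms(3) by (subst sum_Un) (auto simp: sum_nonneg)
  then show ?case using insert by fastforce
qed simp

text \<open>Each covering clique contributes at most 1; nonnegativity makes overlaps and surplus
  nodes harmless.\<close>

lemma sum_le_sum_clique_cover:
  fixes x :: "'a \<Rightarrow> real"
  assumes nonneg: "\<And>i. 0 \<le> x i"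
    and clq: "\<And>Q. clique G Q \<Longrightarrow> sum x Q \<le> 1"
    and cover: "A \<subseteq> (\<Union>r<m. K r)" "\<And>r. r < m \<Longrightarrow> clique G (K r)" "\<And>r. r < m \<Longrightarrow> finite (K r)"
  shows "sum x A \<le> real m"
proof -
  have "sum x A \<le> sum x (\<Union>r<m. K r)"
    using cover nonneg by (intro sum_mono2) auto
  also have "\<dots> \<le> (\<Sum>r<m. sum x (K r))"
    using cover nonneg by (intro sum_UN_le) auto
  also have "\<dots> \<le> (\<Sum>r<m. 1)" using clq cover by (intro sum_mono) auto
  finally show ?thesis by simp
qed

lemma line_graph_antiweb_constraint:
  fixes H :: "('v, 'e::finite) multigraph" and x :: "'e \<Rightarrow> real"
  defines "G \<equiv> line_graph H"
  assumes wf: "wf_multigraph H" and nonneg: "\<And>i. 0 \<le> x i"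
    and clq: "\<And>Q. clique G Q \<Longrightarrow> sum x Q \<le> 1"
    and hole: "\<And>k C. odd_hole G k C \<Longrightarrow> sum x C \<le> real k"
    and A: "A \<subseteq> nodes G" "is_antiweb (induced_subgraph G A)"
  shows "sum x A \<le> real (stability_number (induced_subgraph G A))"
proof -
  let ?\<alpha> = "stability_number (induced_subgraph G A)"
  obtain k n where n: "n \<ge> 1" and gi: "graph_iso (antiweb k n) (induced_subgraph G A)"
    using A(2) by (auto simp: is_antiweb_def)
  then obtain f where bij: "bij_betw f {..<n} A"
    and iso: "\<And>i j. i < n \<Longrightarrow> j < n \<Longrightarrow> adj (antiweb k n) i j \<longleftrightarrow> adj G (f i) (f j)"
    using A(1) by (auto simp: graph_iso_def Int_absorb1 bij_betw_apply)
  have fA: "f ` {..<n} = A" and inj: "inj_on f {..<n}" using bij by (auto simp: bij_betw_def)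
  \<comment> \<open>Initial segments are the only stable sets needed in the cases below.\<close>
  have \<alpha>: "m \<le> ?\<alpha>" if S: "stable_set (antiweb k n) {..<m}" for m
  proof -
    have "\<not> adj G (f u) (f v)" if "u < m" "v < m" for u v
      using S iso[of u v] that by (auto simp: stable_set_def)
    moreover have "m \<le> n" using S by (simp add: stable_set_def)
    ultimately have "stable_set (induced_subgraph G A) (f ` {..<m})"
      using fA A(1) unfolding stable_set_def by fastforce
    then have "card (f ` {..<m}) \<le> ?\<alpha>"
      by (intro card_le_stability_number) auto
    moreover have "card (f ` {..<m}) = m"
      using \<open>m \<le> n\<close> inj by (subst card_image) (auto intro: inj_on_subset)
    ultimately show ?thesis by simp
  qed
  \<comment> \<open>A cover by \<open>m\<close> cliques bounds the sum by \<open>m\<close>, and a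
    stable set of size \<open>m\<close> gives \<open>m \<le> ?\<alpha>\<close>.\<close>
  have cover: ?thesis
    if K: "{..<n} \<subseteq> (\<Union>r<m. K r)" "\<And>r. r < m \<Longrightarrow> clique (antiweb k n) (K r)"
      and S: "stable_set (antiweb k n) {..<m}" for m K
  proof -
    have "sum x A \<le> real m"
    proof (rule sum_le_sum_clique_cover[where K = "\<lambda>r. f ` K r"])
      show "A \<subseteq> (\<Union>r<m. f ` K r)" using K(1) fA by blast
      show "clique G (f ` K r)" if "r < m" for r
      proof -
        have "K r \<subseteq> {..<n}" and K_adj: "\<And>i j. i \<in> K r \<Longrightarrow> j \<in> K r \<Longrightarrow> i \<noteq> j \<Longrightarrow> adj (antiweb k n) i j"
          using K(2)[OF \<open>r < m\<close>] by (auto simp: clique_def)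
        then have "f ` K r \<subseteq> nodes G" using fA A(1) by blast
        moreover have "adj G (f i) (f j)" if "i \<in> K r" "j \<in> K r" "f i \<noteq> f j" for i j
          using that K_adj[of i j] iso[of i j] \<open>K r \<subseteq> {..<n}\<close> by auto
        ultimately show ?thesis by (auto simp: clique_def)
      qed
    qed (use nonneg clq in auto)
    then show ?thesis using \<alpha>[OF S] by simp
  qed
  have "k \<le> 1 \<or> k = 2 \<or> k \<ge> 3" "n < 2 * k \<or> n = 2 * k \<or> n = 2 * k + 1 \<or> n \<ge> 2 * k + 2"
    "k = 2 \<Longrightarrow> n \<ge> 2 * k + 2 \<Longrightarrow> n \<ge> 6" "k = 2 \<Longrightarrow> k \<ge> 2" "k \<ge> 3 \<Longrightarrow> k \<ge> 2"
    by linarith+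
  moreover have "n \<ge> 7" if "odd n" "n \<ge> 6"
    using that by (cases "n = 6") auto
  ultimately consider "k \<le> 1" | "k \<ge> 2" "n < 2 * k" | "k \<ge> 2" "n = 2 * k" | "k \<ge> 2" "n = 2 * k + 1"
    | "k \<ge> 3" "n \<ge> 2 * k + 2" | "k = 2" "n \<ge> 6" "even n" | "k = 2" "n \<ge> 7" "odd n"
    by blast
  then show ?thesis
  proof cases
    case 1
    \<comment> \<open>The antiweb is complete.\<close>
    then show ?thesis
      using n by (intro cover[where m = 1 and K = "\<lambda>_. {..<n}"]) (auto simp: clique_def stable_set_def antiweb_def)
  next
    case 2
    \<comment> \<open>The antiweb has no edges, because \<open>n - k < k\<close>.\<close>
    then show ?thesis
      by (intro cover[where m = n and K = "\<lambda>r. {r}"]) (auto simp: clique_def stable_set_def antiweb_def)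
  next
    case 3
    \<comment> \<open>The antiweb is a perfect matching: \<open>k\<close> is the only permitted
      difference.\<close>
    show ?thesis
    proof (intro cover[where m = k and K = "\<lambda>r. {r, r + k}"] subsetI)
      show "i \<in> (\<Union>r<k. {r, r + k})" if "i \<in> {..<n}" for i
        using that 3 by (cases "i < k") (auto intro!: bexI[of _ "i - k"])
    qed (use 3 in \<open>auto simp: clique_def stable_set_def antiweb_def\<close>)
  next
    case 4
    have "odd_hole G k A"
      using 4 A(1) gi graph_iso_trans[OF cycle_graph_iso_antiweb, of k] by (simp add: odd_hole_def)
    then have "sum x A \<le> real k" by (rule hole)
    moreover have "k \<le> ?\<alpha>"
      using 4 by (intro \<alpha>) (auto simp: stable_set_def antiweb_def)
    ultimately show ?thesis by simp
  next
    case 5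
    \<comment> \<open>Node 0 is adjacent to \<open>k\<close>, \<open>k + 1\<close> and
      \<open>k + 2\<close>, because \<open>k + 2 \<le> n - k\<close>. These three differ pairwise by
      at most 2, which is less than \<open>k\<close>, so they would form a claw with 0.\<close>
    have "adj G (f k) (f (k + 1)) \<or> adj G (f k) (f (k + 2)) \<or> adj G (f (k + 1)) (f (k + 2))"
      unfolding G_def
    proof (rule line_graph_claw_free[OF wf])
      have "adj (antiweb k n) 0 i" if "i \<in> {k, k + 1, k + 2}" for i
        using that 5 by (auto simp: antiweb_def)
      then show "adj (line_graph H) (f 0) e" if "e \<in> {f k, f (k + 1), f (k + 2)}" for e
        using that 5 iso unfolding G_def by fastforce
    qed (use 5 inj in \<open>auto simp: inj_on_eq_iff\<close>)
    then have "adj (antiweb k n) k (k + 1) \<or> adj (antiweb k n) k (k + 2)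
        \<or> adj (antiweb k n) (k + 1) (k + 2)"
      using 5 iso by auto
    then show ?thesis using 5 by (auto simp: antiweb_def)
  next
    case 6
    \<comment> \<open>For even \<open>n\<close> the two parity classes are cliques: distinct members
      differ by an even number between 2 and \<open>n - 2\<close>. The stable set is
      \<open>{0, 1}\<close>.\<close>
    show ?thesis
    proof (intro cover[where m = 2 and K = "\<lambda>r. {i. i < n \<and> i mod 2 = r}"])
      show "clique (antiweb k n) {i. i < n \<and> i mod 2 = r}" if "r < 2" for r
      proof -
        have "2 \<le> \<bar>int i - int j\<bar> \<and> \<bar>int i - int j\<bar> \<le> int n - 2"
          if "i < n" "j < n" "i mod 2 = j mod 2" "i \<noteq> j" for i j
        proof -
          have "even (int i - int j)" using that(3) by (auto simp: mod2_eq_if split: if_splits)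
          then obtain c where c: "int i - int j = 2 * c" by (elim evenE)
          obtain l where l: "int n = 2 * int l" using \<open>even n\<close> by (auto elim: evenE)
          have "c \<noteq> 0" "- int l < c" "c < int l" using that c l by linarith+
          then show ?thesis unfolding c l by linarith
        qed
        then show ?thesis using 6 by (auto simp: clique_def antiweb_def)
      qed
    qed (use 6 in \<open>auto simp: stable_set_def antiweb_def\<close>)
  next
    case 7
    then show ?thesis
      using line_graph_no_odd_antihole[OF wf, of n f] inj fA A(1) iso by (auto simp: G_def)
  qed
qed


section \<open>Joins in line graphs\<close>

text \<open>Adjacency comes from the chosen clique within a part and from the join between
  parts.\<close>

lemma is_complete_join_cliques:
  assumes join: "is_complete_join (induced_subgraph G W) Ps"
    and C: "\<And>i. i < length Ps \<Longrightarrow> clique G (C i)" "\<And>i. i < length Ps \<Longrightarrow> C i \<subseteq> Ps ! i"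
  shows "clique G (\<Union>i<length Ps. C i)"
  unfolding clique_def
proof (intro conjI ballI impI)
  show "(\<Union>i<length Ps. C i) \<subseteq> nodes G" using C by (auto simp: clique_def)
next
  fix u v assume "u \<in> (\<Union>i<length Ps. C i)" "v \<in> (\<Union>i<length Ps. C i)" "u \<noteq> v"
  then obtain i j where ij: "i < length Ps" "j < length Ps" "u \<in> C i" "v \<in> C j" by auto
  show "adj G u v"
  proof (cases "i = j")
    case True
    then show ?thesis using ij C(1) \<open>u \<noteq> v\<close> by (auto simp: clique_def)
  next
    case False
    then show ?thesis using ij C(2) join unfolding is_complete_join_def adj_induced_subgraph
      by blast
  qed
qed

lemma clique_if_stability_number_le_1:
  assumes "simple_graph G" "A \<subseteq> nodes G" "stability_number (induced_subgraph G A) \<le> 1"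
  shows "clique G A"
  unfolding clique_def
proof (intro conjI ballI impI)
  fix u v assume uv: "u \<in> A" "v \<in> A" "u \<noteq> v"
  show "adj G u v"
  proof (rule ccontr)
    assume "\<not> adj G u v"
    then have "stable_set (induced_subgraph G A) {u, v}"
      using assms(1,2) uv by (auto simp: stable_set_def simple_graph_def)
    then have "card {u, v} \<le> stability_number (induced_subgraph G A)"
      using assms(1) by (intro card_le_stability_number) (auto simp: simple_graph_def)
    then show False using uv assms(3) by simp
  qed
qed (use assms in auto)

text \<open>In each part, cliques \<open>C\<close> and \<open>D\<close> are chosen whose average
  weight bounds the part's contribution. All the \<open>C\<close> together form one clique, and so
  do all the \<open>D\<close>. The assumption \<open>nbr\<close> supplies a node outside the part
  whose neighbourhood contains the part.\<close>

lemma line_graph_join_constraint: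
  fixes H :: "('v, 'e::finite) multigraph" and x :: "'e \<Rightarrow> real"
  defines "G \<equiv> line_graph H"
  assumes wf: "wf_multigraph H" and nonneg: "\<And>i. 0 \<le> x i"
    and clq: "\<And>Q. clique G Q \<Longrightarrow> sum x Q \<le> 1"
    and join: "is_complete_join (induced_subgraph G (\<Union> (set As) \<union> Q)) (As @ [Q])"
    and As: "\<And>A. A \<in> set As \<Longrightarrow> A \<subseteq> nodes G" and Q: "clique G Q"
    and nbr: "\<And>i. i < length As \<Longrightarrow> \<exists>j<length (As @ [Q]). j \<noteq> i \<and> (As @ [Q]) ! j \<noteq> {}"
  shows "(\<Sum>A\<leftarrow>As. 1 / real (stability_number (induced_subgraph G A)) * sum x A) + sum x Q \<le> 1"
proof -
  define Ps where "Ps = As @ [Q]"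
  \<comment> \<open>The contribution of each part to the left-hand side; \<open>Q\<close> is the
    part with index \<open>length As\<close>.\<close>
  define w where "w = (\<lambda>i. if i < length As
    then 1 / real (stability_number (induced_subgraph G (As ! i))) * sum x (As ! i) else sum x Q)"
  have simple: "simple_graph G" using wf by (simp add: G_def simple_graph_line_graph)
  have "\<exists>C D. clique G C \<and> clique G D \<and> C \<subseteq> Ps ! i \<and> D \<subseteq> Ps ! i \<and> w i \<le> (sum x C + sum x D) / 2"
    if i: "i < length Ps" for i
  proof (cases "i < length As")
    case False
    then show ?thesis using i Q by (intro exI[of _ Q]) (auto simp: Ps_def w_def nth_append)
  next
    case True
    let ?A = "As ! i"
    let ?\<alpha> = "stability_number (induced_subgraph G ?A)"
    have PsA: "Ps ! i = ?A" using True by (simp add: Ps_def nth_append)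
    have sub: "?A \<subseteq> nodes G" using As True by simp
    show ?thesis
    proof (cases "?\<alpha> \<le> 1")
      case \<alpha>: True
      then have "clique G ?A" by (rule clique_if_stability_number_le_1[OF simple sub])
      \<comment> \<open>This includes \<open>?\<alpha> = 0\<close>, where the quotient is 0 by
        convention.\<close>
      moreover have "1 / real ?\<alpha> * sum x ?A \<le> 1 * sum x ?A"
        using nonneg \<alpha> by (intro mult_right_mono sum_nonneg) (cases ?\<alpha>; auto)+
      ultimately show ?thesis
        using PsA True by (intro exI[of _ ?A]) (auto simp: w_def)
    next
      case False
      obtain j where j: "j < length Ps" "j \<noteq> i" "Ps ! j \<noteq> {}"
        using nbr[OF True] by (auto simp: Ps_def)
      then obtain c where c: "c \<in> Ps ! j" by blast
      have "adj (line_graph H) c e" if "e \<in> ?A" for e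
        using join j i c that PsA unfolding is_complete_join_def Ps_def[symmetric]
          adj_induced_subgraph G_def[symmetric] by blast
      then obtain C D where CD: "clique G C" "clique G D" "?A = C \<union> D"
        using line_graph_neighbourhood_cliques[OF wf] unfolding G_def by metis
      \<comment> \<open>Here \<open>?\<alpha> \<ge> 2\<close>, and this yields the factor one half
        of the average.\<close>
      have "1 / real ?\<alpha> * sum x ?A \<le> 1 / 2 * sum x ?A"
        using False nonneg by (intro mult_right_mono sum_nonneg) (auto simp: field_simps)
      also have "sum x ?A \<le> sum x C + sum x D"
        unfolding CD(3) using nonneg by (simp add: sum_Un sum_nonneg)
      finally have "w i \<le> (sum x C + sum x D) / 2" using True by (simp add: w_def)
      then show ?thesis using CD PsA by auto
    qed
  qed
  then obtain C D where CD: "\<And>i. i < length Ps \<Longrightarrow> clique G (C i)" "\<And>i. i < length Ps \<Longrightarrow> clique G (D i)"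
    "\<And>i. i < length Ps \<Longrightarrow> C i \<subseteq> Ps ! i" "\<And>i. i < length Ps \<Longrightarrow> D i \<subseteq> Ps ! i"
    "\<And>i. i < length Ps \<Longrightarrow> w i \<le> (sum x (C i) + sum x (D i)) / 2"
    by metis
  \<comment> \<open>The parts are disjoint, so the sum is the weight of a single clique.\<close>
  have le: "(\<Sum>i<length Ps. sum x (K i)) \<le> 1"
    if K: "\<And>i. i < length Ps \<Longrightarrow> clique G (K i)" "\<And>i. i < length Ps \<Longrightarrow> K i \<subseteq> Ps ! i" for K
  proof -
    have "K i \<inter> K j = {}" if "i < length Ps" "j < length Ps" "i \<noteq> j" for i j
      using join that K(2) unfolding is_complete_join_def Ps_def[symmetric] by blast
    then have "(\<Sum>i<length Ps. sum x (K i)) = sum x (\<Union>i<length Ps. K i)"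
      by (intro sum.UNION_disjoint[symmetric]) auto
    also have "\<dots> \<le> 1"
      by (intro clq is_complete_join_cliques[OF join[folded Ps_def]] K)
    finally show ?thesis .
  qed
  have "(\<Sum>A\<leftarrow>As. 1 / real (stability_number (induced_subgraph G A)) * sum x A) + sum x Q
      = (\<Sum>i<length As. w i) + w (length As)"
    by (simp add: sum_list_sum_nth w_def atLeast0LessThan)
  also have "\<dots> = (\<Sum>i<length Ps. w i)" by (simp add: Ps_def)
  also have "\<dots> \<le> (\<Sum>i<length Ps. (sum x (C i) + sum x (D i)) / 2)"
    using CD(5) by (intro sum_mono) auto
  also have "\<dots> = ((\<Sum>i<length Ps. sum x (C i)) + (\<Sum>i<length Ps. sum x (D i))) / 2"
    by (simp add: sum.distrib sum_divide_distrib[symmetric])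
  also have "\<dots> \<le> 1" using le[OF CD(1,3)] le[OF CD(2,4)] by simp
  finally show ?thesis .
qed

lemma line_graph_joined_antiweb_constraint:
  fixes H :: "('v, 'e::finite) multigraph" and x :: "'e \<Rightarrow> real"
  defines "G \<equiv> line_graph H"
  assumes wf: "wf_multigraph H" and nonneg: "\<And>i. 0 \<le> x i"
    and clq: "\<And>Q. clique G Q \<Longrightarrow> sum x Q \<le> 1"
    and hole: "\<And>k C. odd_hole G k C \<Longrightarrow> sum x C \<le> real k"
    and ja: "joined_antiweb G As Q"
  shows "(\<Sum>A\<leftarrow>As. 1 / real (stability_number (induced_subgraph G A)) * sum x A) + sum x Q \<le> 1"
proof -
  have As: "A \<subseteq> nodes G" "is_antiweb (induced_subgraph G A)" if "A \<in> set As" for A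
    using ja that by (auto simp: joined_antiweb_def)
  have Q: "clique G Q"
    and join: "is_complete_join (induced_subgraph G (\<Union> (set As) \<union> Q)) (As @ [Q])"
    using ja by (auto simp: joined_antiweb_def)
  have ne: "A \<noteq> {}" if "A \<in> set As" for A
  proof -
    have "is_antiweb (induced_subgraph G A)" using As(2) that .
    then obtain k n where "n \<ge> 1" "graph_iso (antiweb k n) (induced_subgraph G A)"
      by (auto simp: is_antiweb_def)
    then obtain f where "f ` {..<n} = nodes G \<inter> A" "0 \<in> {..<n}"
      by (auto simp: graph_iso_def bij_betw_def)
    then show ?thesis by blast
  qed
  \<comment> \<open>Either one antiweb stands alone, or every antiweb in the list has another
    nonempty part beside it.\<close>
  consider A where "As = [A]" "Q = {}" | "length As \<noteq> 1 \<or> Q \<noteq> {}"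
    by (auto simp: length_Suc_conv)
  then show ?thesis
  proof cases
    case 1
    then have "sum x A \<le> real (stability_number (induced_subgraph G A))"
      using line_graph_antiweb_constraint[OF wf nonneg clq[unfolded G_def] hole[unfolded G_def]] As
      by (simp add: G_def)
    then show ?thesis using 1 by (auto simp: divide_le_eq_1)
  next
    case 2
    have "\<exists>j<length (As @ [Q]). j \<noteq> i \<and> (As @ [Q]) ! j \<noteq> {}" if i: "i < length As" for i
    proof (cases "Q = {}")
      case False
      then show ?thesis using i by (intro exI[of _ "length As"]) auto
    next
      case True
      then have "length As \<ge> 2" using 2 i by auto
      then have "\<exists>j<length As. j \<noteq> i"
        by (intro exI[of _ "if i = 0 then 1 else 0"]) auto
      then obtain j where "j < length As" "j \<noteq> i" by blast
      then show ?thesis using ne by (intro exI[of _ j]) (auto simp: nth_append)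
    qed
    then show ?thesis
      using line_graph_join_constraint[OF wf nonneg clq[unfolded G_def] join[unfolded G_def] _
          Q[unfolded G_def]] As(1)
      unfolding G_def by blast
  qed
qed

section \<open>Comparison of the two systems of constraints\<close>

lemma joined_antiweb_clique:
  "clique G Q \<Longrightarrow> joined_antiweb G [] Q"
  by (auto simp: joined_antiweb_def is_complete_join_def clique_def)

lemma joined_antiweb_odd_hole:
  assumes "odd_hole G k C"
  shows "joined_antiweb G [C] {}"
proof -
  have "C \<subseteq> nodes G" using assms by (simp add: odd_hole_def)
  then show ?thesis
    using odd_hole_is_antiweb[OF assms]
    by (auto simp: joined_antiweb_def clique_def is_complete_join_def less_Suc_eq)
qed

theorem theorem5:
  fixes H :: "('v, 'e::finite) multigraph"
    and G :: "'e graph"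
  assumes "wf_multigraph H"
    and "G = line_graph H"
  shows "joined_a_perfect G \<longleftrightarrow> h_perfect G"
proof -
  have simple: "simple_graph G" using assms simple_graph_line_graph by simp
  have "(\<forall>As Q. joined_antiweb G As Q \<longrightarrow>
        (\<Sum>A\<leftarrow>As. 1 / real (stability_number (induced_subgraph G A)) * (\<Sum>i\<in>A. x $ i))
          + (\<Sum>i\<in>Q. x $ i) \<le> 1)
    \<longleftrightarrow> (\<forall>Q. clique G Q \<longrightarrow> (\<Sum>i\<in>Q. x $ i) \<le> 1) \<and>
       (\<forall>k C. odd_hole G k C \<longrightarrow> (\<Sum>i\<in>C. x $ i) \<le> real k)" (is "?J \<longleftrightarrow> ?C \<and> ?O")
    if "x \<in> vectors_on G" "\<forall>i\<in>nodes G. 0 \<le> x $ i" for x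
  proof -
    \<comment> \<open>Coordinates outside the node set vanish, so nonnegativity extends to every
      index.\<close>
    have nonneg: "0 \<le> x $ i" for i
      using that by (cases "i \<in> nodes G") (auto simp: vectors_on_def)
    show ?thesis
    proof (intro iffI)
      assume J: ?J
      have ?C
        using J joined_antiweb_clique by fastforce
      moreover have "(\<Sum>i\<in>C. x $ i) \<le> real k" if hole: "odd_hole G k C" for k C
      proof -
        let ?\<alpha> = "stability_number (induced_subgraph G C)"
        have "C \<subseteq> nodes G" "C \<noteq> {}"
          using hole by (auto simp: odd_hole_def graph_iso_def bij_betw_def)
        \<comment> \<open>A single node is stable, so \<open>?\<alpha>\<close> is positive and the
          denominator can be cleared.\<close>
        then obtain i where "stable_set (induced_subgraph G C) {i}"
          using simple by (auto simp: stable_set_def simple_graph_def)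
        then have "1 \<le> ?\<alpha>"
          using card_le_stability_number[of "induced_subgraph G C" "{i}"] by simp
        moreover have "1 / real ?\<alpha> * (\<Sum>i\<in>C. x $ i) \<le> 1"
          using J joined_antiweb_odd_hole[OF hole] by fastforce
        ultimately have "(\<Sum>i\<in>C. x $ i) \<le> real ?\<alpha>" by (simp add: field_simps)
        then show ?thesis using odd_hole_stability_number[OF hole] by simp
      qed
      ultimately show "?C \<and> ?O" by blast
    next
      assume "?C \<and> ?O"
      then show ?J
        using line_graph_joined_antiweb_constraint[OF assms(1), of "($) x"] nonneg
        unfolding assms(2) by blast
    qed
  qed
  then have "ASTAB_star G = {x \<in> vectors_on G. (\<forall>i\<in>nodes G. 0 \<le> x $ i) \<and>
     (\<forall>Q. clique G Q \<longrightarrow> (\<Sum>i\<in>Q. x $ i) \<le> 1) \<and>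
     (\<forall>k C. odd_hole G k C \<longrightarrow> (\<Sum>i\<in>C. x $ i) \<le> real k)}"
    unfolding ASTAB_star_def by blast
  then show ?thesis by (simp add: joined_a_perfect_def h_perfect_def)
qed

end
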